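(* (Bifurcation Lemma.) Let $(G,i)$ be a rooted graph on $n$ vertices and let $A \in \mathcal{S}(G)$ be a matrix with $i$-SNIP. Then there is an $\epsilon > 0$ such that for every $n\times n$ real symmetric matrix $M$ with $\|M - A\| < \epsilon$, there exists a matrix $A' \in \mathcal{S}(G)$ with $i$-SNIP such that $M$ and $A'$ have the same $i$-nullity pair.
   Context: All graphs are finite and simple. For a graph $G$ on $n$ vertices labeled $1,\dots,n$, $\mathcal{S}(G)$ denotes the set of $n\times n$ real symmetric matrices whose off-diagonal $(j,k)$-entry is nonzero if and only if $\{j,k\}$ is an edge of $G$ (diagonal entries arbitrary). For a matrix $A$ and index $i$, $A(i)$ is the principal submatrix obtained by deleting row $i$ and column $i$, and $(AX)(i,:]$ denotes the matrix $AX$ with row $i$ deleted. $\operatorname{null}$ denotes the dimension of the kernel. The $i$-nullity pair of a symmetric matrix $A$ is $(\operatorname{null}(A),\operatorname{null}(A(i)))$. $\circ$ is the entrywise product. A real symmetric $n\times n$ matrix $A$ has the $i$-strong nullity interlacing property ($i$-SNIP) if the only real symmetric matrix $X$ satisfying $A\circ X = O$, $I\circ X = O$ and $(AX)(i,:] = O$ is $X = O$. A rooted graph $(G,i)$ is a graph $G$ with a designated vertex $i$. $\|\cdot\|$ is any fixed norm on $n\times n$ matrices. *)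

theory Defs
  imports "HOL-Analysis.Analysis"
begin

text \<open>
  The \<open>n\<close> vertices of a graph are the elements of a finite type \<open>'n\<close> with \<open>n = CARD('n)\<close>;
  a graph is given by its set of edges, and \<open>n \<times> n\<close> matrices have type \<open>real^'n^'n\<close>.
\<close>

definition simple_graph :: "'n set set \<Rightarrow> bool" where
  "simple_graph E \<longleftrightarrow> (\<forall>e\<in>E. card e = 2)"

definition symmetric_mat :: "real^'n^'n \<Rightarrow> bool" where
  "symmetric_mat A \<longleftrightarrow> transpose A = A"

definition graph_matrices :: "'n set set \<Rightarrow> (real^'n^'n) set" where
  "graph_matrices E =
     {A. symmetric_mat A \<and> (\<forall>j k. j \<noteq> k \<longrightarrow> (A $ j $ k \<noteq> 0 \<longleftrightarrow> {j, k} \<in> E))}"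

definition nullity :: "real^'n^'n \<Rightarrow> nat" where
  "nullity A = dim {x. A *v x = 0}"

text \<open>
  The principal submatrix \<open>A(i)\<close> has the index set \<open>- {i}\<close>, which is not a type. A vector indexed
  by \<open>- {i}\<close> is represented by the vector over \<open>'n\<close> that extends it by \<open>0\<close> at \<open>i\<close>; under this
  linear identification the following set is the kernel of \<open>A(i)\<close>. The lemma
  \<open>nullity_delete_eq_nullity_submatrix\<close> below confirms that \<open>nullity_delete i A\<close> is the
  nullity of \<open>A(i)\<close> for any re-indexing of \<open>A(i)\<close> by a type.
\<close>

definition kernel_delete :: "'n \<Rightarrow> real^'n^'n \<Rightarrow> (real^'n) set" where
  "kernel_delete i A =
     {x. x $ i = 0 \<and> (\<forall>j\<in>- {i}. (\<Sum>k\<in>- {i}. A $ j $ k * x $ k) = 0)}"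

definition nullity_delete :: "'n \<Rightarrow> real^'n^'n \<Rightarrow> nat" where
  "nullity_delete i A = dim (kernel_delete i A)"

lemma nullity_delete_eq_nullity_submatrix:
  fixes A :: "real^'n^'n" and f :: "'m::finite \<Rightarrow> 'n" and i :: 'n
  assumes "bij_betw f UNIV (- {i})"
  shows "nullity_delete i A = nullity (\<chi> a b. A $ f a $ f b)"
proof -
  let ?B = "\<chi> a b. A $ f a $ f b"
  let ?r = "\<lambda>x::real^'n. \<chi> a. x $ f a"
  let ?U = "{x::real^'n. x $ i = 0}"
  have rng: "range f = - {i}" and inj: "inj f"
    using assms by (auto simp: bij_betw_def)
  have lin: "linear ?r"
    by (rule linearI) (auto simp: vec_eq_iff)
  have sub: "subspace ?U"
    by (auto simp: subspace_def)
  have span: "span (kernel_delete i A) \<subseteq> ?U"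
    by (rule span_minimal[OF _ sub]) (auto simp: kernel_delete_def)
  have inj_r: "inj_on ?r ?U"
  proof (rule inj_onI)
    fix x y assume xy: "x \<in> ?U" "y \<in> ?U" "?r x = ?r y"
    have "x $ j = y $ j" for j
    proof (cases "j = i")
      case False
      then obtain a where "j = f a" using rng by blast
      then show ?thesis using xy(3) by (simp add: vec_eq_iff)
    qed (use xy in auto)
    then show "x = y" by (simp add: vec_eq_iff)
  qed
  have sum: "(\<Sum>k\<in>- {i}. A $ j $ k * x $ k) = (\<Sum>b\<in>UNIV. A $ j $ f b * x $ f b)" for j x
    by (rule sum.reindex_bij_betw[OF assms, symmetric])
  have ker: "kernel_delete i A = {x \<in> ?U. ?B *v ?r x = 0}"
    unfolding kernel_delete_def
    by (simp only: sum) (auto simp: rng[symmetric] matrix_vector_mult_def vec_eq_iff)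
  have img: "?r ` kernel_delete i A = {y. ?B *v y = 0}"
  proof (intro equalityI subsetI)
    fix y :: "real^'m" assume y: "y \<in> {y. ?B *v y = 0}"
    define x :: "real^'n" where "x = (\<chi> j. if j = i then 0 else y $ inv f j)"
    have "f a \<noteq> i" for a using rng by auto
    then have rx: "?r x = y" using inj by (simp add: x_def vec_eq_iff)
    have "x $ i = 0" by (simp add: x_def)
    with rx y have "x \<in> kernel_delete i A" unfolding ker by simp
    then show "y \<in> ?r ` kernel_delete i A" using rx by (metis image_eqI)
  qed (auto simp: ker)
  have "dim (?r ` kernel_delete i A) = dim (kernel_delete i A)"
    by (rule dim_image_eq[OF lin]) (rule inj_on_subset[OF inj_r span])
  then show ?thesis
    unfolding nullity_delete_def nullity_def img by simp
qed

definition nullity_pair :: "'n \<Rightarrow> real^'n^'n \<Rightarrow> nat \<times> nat" where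
  "nullity_pair i A = (nullity A, nullity_delete i A)"

definition entrywise_prod :: "real^'n^'n \<Rightarrow> real^'n^'n \<Rightarrow> real^'n^'n" where
  "entrywise_prod A B = (\<chi> j k. A $ j $ k * B $ j $ k)"

definition SNIP :: "'n \<Rightarrow> real^'n^'n \<Rightarrow> bool" where
  "SNIP i A \<longleftrightarrow> symmetric_mat A \<and>
     (\<forall>X. symmetric_mat X \<and> entrywise_prod A X = 0 \<and> entrywise_prod (mat 1) X = 0 \<and>
          (\<forall>j k. j \<noteq> i \<longrightarrow> (A ** X) $ j $ k = 0)
        \<longrightarrow> X = 0)"

definition is_norm :: "('a::real_vector \<Rightarrow> real) \<Rightarrow> bool" where
  "is_norm N \<longleftrightarrow>
     (\<forall>x. 0 \<le> N x) \<and> (\<forall>x. N x = 0 \<longleftrightarrow> x = 0) \<and>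
     (\<forall>c x. N (c *\<^sub>R x) = \<bar>c\<bar> * N x) \<and> (\<forall>x y. N (x + y) \<le> N x + N y)"

end

theory Submission
  imports Defs
begin

text \<open>
  Congruence by an invertible \<open>C\<close> whose \<open>i\<close>-th row is that of the identity preserves the
  \<open>i\<close>-nullity pair. Such \<open>C\<close> near the identity, together with the perturbations \<open>B\<close> of \<open>A\<close> inside
  its pattern, give a map \<open>(C, B) \<mapsto> C\<^sup>T (A + B) C\<close> into the symmetric matrices. The orthogonal
  complement of the range of its derivative at \<open>(I, 0)\<close> consists of the matrices \<open>X\<close>
  in the definition of the \<open>i\<close>-SNIP, so the derivative is onto and the map covers a
  neighbourhood of \<open>A\<close>. Being injectivity of a linear map that depends continuously on the
  matrix, the \<open>i\<close>-SNIP is an open condition within the pattern, hence \<open>A' = A + B\<close>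
  inherits it.
\<close>

section \<open>Norm comparison and stability of injectivity\<close>

text \<open>Expansion in the basis shows that \<open>N\<close> is Lipschitz for the Euclidean norm,
  so it attains a minimum on the compact unit sphere; this is positive by definiteness and serves as
  \<open>c\<close>. The bound turns closeness in \<open>N\<close> into membership in a Euclidean
  ball.\<close>

lemma is_norm_ge_scaled_norm:
  fixes N :: "'a::euclidean_space \<Rightarrow> real"
  assumes "is_norm N"
  obtains c where "c > 0" "\<And>x. c * norm x \<le> N x"
proof -
  have pos: "0 \<le> N x" and zero: "N x = 0 \<longleftrightarrow> x = 0" and scale: "N (a *\<^sub>R x) = \<bar>a\<bar> * N x"
    and tri: "N (x + y) \<le> N x + N y" for a x y
    using assms by (auto simp: is_norm_def)
  define K where "K = (\<Sum>b\<in>Basis. N b)"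
  have sum: "N (sum g F) \<le> (\<Sum>b\<in>F. N (g b))" if "finite F" for g and F :: "'a set"
    using that
  proof (induction F rule: finite_induct)
    case (insert b F)
    then show ?case using tri[of "g b" "sum g F"] by simp
  qed (use zero[of 0] in simp)
  have upper: "N x \<le> K * norm x" for x
  proof -
    have "N x = N (\<Sum>b\<in>Basis. (x \<bullet> b) *\<^sub>R b)"
      by (simp add: euclidean_representation)
    also have "\<dots> \<le> (\<Sum>b\<in>Basis. N ((x \<bullet> b) *\<^sub>R b))"
      by (rule sum) simp
    also have "\<dots> \<le> (\<Sum>b\<in>Basis. norm x * N b)"
      by (intro sum_mono) (simp add: scale Basis_le_norm mult_right_mono pos)
    finally show ?thesis
      by (simp add: K_def sum_distrib_left mult.commute)
  qed
  have "\<bar>N x - N y\<bar> \<le> K * dist x y" for x y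
  proof -
    have "N x \<le> N (x - y) + N y" "N y \<le> N (y - x) + N x"
      using tri[of "x - y" y] tri[of "y - x" x] by auto
    then show ?thesis
      using upper[of "x - y"] upper[of "y - x"] by (simp add: dist_norm norm_minus_commute)
  qed
  moreover have "0 \<le> K"
    unfolding K_def by (intro sum_nonneg pos)
  ultimately have "K-lipschitz_on UNIV N"
    by (intro lipschitz_onI) (auto simp: dist_real_def)
  then have "continuous_on (sphere 0 1) N"
    using lipschitz_on_continuous_on continuous_on_subset by blast
  moreover have "sphere (0::'a) 1 \<noteq> {}"
    by simp
  ultimately obtain u where u: "u \<in> sphere 0 1" "\<And>x. x \<in> sphere 0 1 \<Longrightarrow> N u \<le> N x"
    using continuous_attains_inf[OF compact_sphere] by blast
  show ?thesis
  proof
    show "N u > 0"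
      using u(1) pos[of u] zero[of u] by (cases "u = 0") auto
    show "N u * norm x \<le> N x" for x
    proof (cases "x = 0")
      case False
      then have "N u \<le> N (inverse (norm x) *\<^sub>R x)"
        by (intro u(2)) simp
      then show ?thesis
        using False by (simp add: scale field_simps)
    qed (simp add: pos)
  qed
qed

text \<open>In finite dimension an injective linear map on a subspace is bounded below by some
  \<open>c > 0\<close>. Moving the parameter by less than \<open>c / K\<close> changes the map by
  less than \<open>c\<close> in operator norm, so no kernel can appear. This serves both for the
  SNIP and for invertibility near the identity.\<close>

lemma eventually_bilinear_injective_on:
  fixes h :: "'a::real_normed_vector \<Rightarrow> 'b::euclidean_space \<Rightarrow> 'c::euclidean_space"
  assumes "bounded_bilinear h" and "subspace S" and inj: "\<forall>x\<in>S. h a x = 0 \<longrightarrow> x = 0"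
  shows "\<forall>\<^sub>F b in nhds a. \<forall>x\<in>S. h b x = 0 \<longrightarrow> x = 0"
proof -
  interpret h: bounded_bilinear h by fact
  obtain c where c: "c > 0" "\<And>x. x \<in> S \<Longrightarrow> c * norm x \<le> norm (h a x)"
    using injective_imp_isometric[OF closed_subspace[OF \<open>subspace S\<close>] \<open>subspace S\<close>
        h.bounded_linear_right inj] by (auto simp: mult.commute)
  obtain K where K: "K > 0" "\<And>y x. norm (h y x) \<le> norm y * norm x * K"
    using h.pos_bounded by blast
  have "x = 0" if b: "dist b a < c / K" and x: "x \<in> S" "h b x = 0" for b x
  proof (rule ccontr)
    assume "x \<noteq> 0"
    \<comment> \<open>As \<open>h b x = 0\<close>, the vector \<open>h a x\<close> equals
      \<open>h (a - b) x\<close>.\<close>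
    have "c * norm x \<le> norm (h (a - b) x)"
      using c(2)[OF x(1)] x(2) by (simp add: h.diff_left)
    also have "\<dots> \<le> (dist b a * K) * norm x"
      using K(2)[of "a - b" x] by (simp add: dist_norm norm_minus_commute mult_ac)
    finally have "c \<le> dist b a * K"
      using \<open>x \<noteq> 0\<close> by simp
    then show False
      using b K(1) by (simp add: field_simps)
  qed
  moreover have "c / K > 0"
    using c K by simp
  ultimately show ?thesis
    unfolding eventually_nhds_metric by blast
qed

lemma bounded_bilinear_matrix_matrix_mult:
  "bounded_bilinear ((**) :: real^'n^'m \<Rightarrow> real^'p^'n \<Rightarrow> real^'p^'m)"
  unfolding bilinear_conv_bounded_bilinear[symmetric] bilinear_def
  by (auto intro!: linearI simp: matrix_matrix_mult_def vec_eq_iff algebra_simps sum.distrib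
      sum_distrib_left)

lemma bounded_bilinear_matrix_vector_mult:
  "bounded_bilinear ((*v) :: real^'n^'m \<Rightarrow> real^'n \<Rightarrow> real^'m)"
  unfolding bilinear_conv_bounded_bilinear[symmetric] bilinear_def
  by (auto intro!: linearI simp: matrix_vector_mult_def vec_eq_iff algebra_simps sum.distrib
      sum_distrib_left)

lemma bounded_linear_transpose:
  "bounded_linear (transpose :: real^'n^'m \<Rightarrow> real^'m^'n)"
  unfolding linear_conv_bounded_linear[symmetric]
  by (auto intro!: linearI simp: transpose_def vec_eq_iff)

lemma inner_transpose_left:
  fixes X :: "real^'n^'m"
  shows "transpose X \<bullet> Y = X \<bullet> transpose Y"
  by (simp add: inner_vec_def transpose_def) (rule sum.swap)

lemma inner_matrix_mult_right:
  fixes A :: "real^'n^'m"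
  shows "X \<bullet> (A ** Y) = (transpose A ** X) \<bullet> Y"
proof -
  have "X \<bullet> (A ** Y) = (\<Sum>j\<in>UNIV. \<Sum>k\<in>UNIV. \<Sum>l\<in>UNIV. X$j$k * (A$j$l * Y$l$k))"
    by (simp add: inner_vec_def matrix_matrix_mult_def sum_distrib_left)
  also have "\<dots> = (\<Sum>j\<in>UNIV. \<Sum>l\<in>UNIV. \<Sum>k\<in>UNIV. X$j$k * (A$j$l * Y$l$k))"
    by (intro sum.cong refl sum.swap)
  also have "\<dots> = (\<Sum>l\<in>UNIV. \<Sum>j\<in>UNIV. \<Sum>k\<in>UNIV. X$j$k * (A$j$l * Y$l$k))"
    by (rule sum.swap)
  also have "\<dots> = (\<Sum>l\<in>UNIV. \<Sum>k\<in>UNIV. \<Sum>j\<in>UNIV. X$j$k * (A$j$l * Y$l$k))"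
    by (intro sum.cong refl sum.swap)
  also have "\<dots> = (transpose A ** X) \<bullet> Y"
    by (simp add: inner_vec_def matrix_matrix_mult_def transpose_def sum_distrib_right
        sum_distrib_left mult_ac)
  finally show ?thesis .
qed

section \<open>The SNIP and perturbations within the pattern\<close>

text \<open>The row is zeroed instead of deleted, which keeps the type and makes the map an
  orthogonal projection. The matrices \<open>mat 1 + drop_row i P\<close> are exactly those whose
  row \<open>i\<close> is that of the identity.\<close>

definition drop_row :: "'n \<Rightarrow> real^'n^'n \<Rightarrow> real^'n^'n" where
  "drop_row i P = (\<chi> j k. if j = i then 0 else P $ j $ k)"

text \<open>The range is the space of symmetric matrices supported on the diagonal and the edges,
  the directions in which \<open>graph_matrices E\<close> may be perturbed. Parametrizing it by an
  arbitrary \<open>Q\<close> keeps the domain a full Euclidean space.\<close>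

definition pattern_sym :: "'n set set \<Rightarrow> real^'n^'n \<Rightarrow> real^'n^'n" where
  "pattern_sym E Q = (\<chi> j k. if j = k \<or> {j, k} \<in> E then Q $ j $ k + Q $ k $ j else 0)"

text \<open>Within the symmetric matrices this is the orthogonal complement of the range of
  \<open>pattern_sym E\<close>.\<close>

definition off_pattern :: "'n set set \<Rightarrow> (real^'n^'n) set" where
  "off_pattern E = {X. symmetric_mat X \<and> (\<forall>j k. j = k \<or> {j, k} \<in> E \<longrightarrow> X $ j $ k = 0)}"

lemma bounded_linear_drop_row: "bounded_linear (drop_row (i::'n::finite))"
  unfolding linear_conv_bounded_linear[symmetric]
  by (auto intro!: linearI simp: drop_row_def vec_eq_iff)

lemma bounded_linear_pattern_sym: "bounded_linear (pattern_sym (E::'n::finite set set))"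
  unfolding linear_conv_bounded_linear[symmetric]
  by (auto intro!: linearI simp: pattern_sym_def vec_eq_iff algebra_simps)

lemma subspace_off_pattern: "subspace (off_pattern (E::'n::finite set set))"
  by (auto simp: subspace_def off_pattern_def symmetric_mat_def transpose_def vec_eq_iff)

lemma inner_drop_row_self: "P \<bullet> drop_row i P = drop_row i P \<bullet> drop_row i P"
  by (auto simp: inner_vec_def drop_row_def intro!: sum.cong)

text \<open>On \<open>graph_matrices E\<close> the two entrywise conditions on \<open>X\<close>
  depend only on \<open>E\<close>. The SNIP thus becomes injectivity on a fixed subspace, to which
  the perturbation argument applies.\<close>

lemma SNIP_iff_injective_on_off_pattern:
  fixes A :: "real^'n^'n"
  assumes "A \<in> graph_matrices E"
  shows "SNIP i A \<longleftrightarrow> (\<forall>X\<in>off_pattern E. drop_row i (A ** X) = 0 \<longrightarrow> X = 0)"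
proof -
  have sym: "symmetric_mat A" and pat: "j \<noteq> k \<Longrightarrow> A $ j $ k \<noteq> 0 \<longleftrightarrow> {j, k} \<in> E" for j k
    using assms by (auto simp: graph_matrices_def)
  have "X \<in> off_pattern E \<longleftrightarrow>
      symmetric_mat X \<and> entrywise_prod A X = 0 \<and> entrywise_prod (mat 1) X = 0" for X
  proof -
    have "entrywise_prod (mat 1) X = 0 \<longleftrightarrow> (\<forall>j. X $ j $ j = 0)"
      by (auto simp: entrywise_prod_def mat_def vec_eq_iff)
    \<comment> \<open>The diagonal of \<open>A\<close> is arbitrary, so only the off-diagonal
      entries of \<open>A\<close> carry information about \<open>E\<close>; the diagonal of
      \<open>X\<close> has to vanish first.\<close>
    moreover have "(\<forall>j. X $ j $ j = 0) \<Longrightarrow>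
        entrywise_prod A X = 0 \<longleftrightarrow> (\<forall>j k. {j, k} \<in> E \<longrightarrow> X $ j $ k = 0)"
      using pat unfolding entrywise_prod_def vec_eq_iff
      by simp (metis mult_zero_right)
    ultimately show ?thesis
      unfolding off_pattern_def by auto
  qed
  moreover have "drop_row i Y = 0 \<longleftrightarrow> (\<forall>j k. j \<noteq> i \<longrightarrow> Y $ j $ k = 0)" for Y :: "real^'n^'n"
    by (auto simp: drop_row_def vec_eq_iff)
  ultimately show ?thesis
    using sym unfolding SNIP_def by blast
qed

text \<open>Nonzero entries stay nonzero by continuity, and \<open>pattern_sym\<close> leaves the
  off-diagonal non-edges at zero, so the pattern survives; the SNIP survives by stability of
  injectivity.\<close>

lemma eventually_graph_matrices_SNIP:
  fixes A :: "real^'n^'n"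
  assumes A: "A \<in> graph_matrices E" and "SNIP i A"
  shows "\<forall>\<^sub>F B in nhds 0. A + pattern_sym E B \<in> graph_matrices E \<and> SNIP i (A + pattern_sym E B)"
proof -
  have "((\<lambda>B. A + pattern_sym E B) \<longlongrightarrow> A + pattern_sym E 0) (nhds 0)"
    by (intro tendsto_intros bounded_linear.tendsto[OF bounded_linear_pattern_sym] filterlim_ident)
  then have lim: "((\<lambda>B. A + pattern_sym E B) \<longlongrightarrow> A) (nhds 0)"
    by (simp add: bounded_linear.linear[OF bounded_linear_pattern_sym] linear_0)
  have "bounded_bilinear (\<lambda>A X. drop_row i (A ** X))"
    unfolding bilinear_conv_bounded_bilinear[symmetric] bilinear_def
    by (auto intro!: linearI simp: drop_row_def matrix_matrix_mult_def vec_eq_iff algebra_simps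
        sum.distrib sum_distrib_left)
  then have "\<forall>\<^sub>F B in nhds A. \<forall>X\<in>off_pattern E. drop_row i (B ** X) = 0 \<longrightarrow> X = 0"
    using assms subspace_off_pattern
    by (intro eventually_bilinear_injective_on) (auto simp: SNIP_iff_injective_on_off_pattern)
  then have inj: "\<forall>\<^sub>F B in nhds 0. \<forall>X\<in>off_pattern E.
      drop_row i ((A + pattern_sym E B) ** X) = 0 \<longrightarrow> X = 0"
    using lim by (rule eventually_compose_filterlim)
  have "\<forall>\<^sub>F B in nhds 0. A $ j $ k \<noteq> 0 \<longrightarrow> (A + pattern_sym E B) $ j $ k \<noteq> 0" for j k
  proof (cases "A $ j $ k = 0")
    case False
    then show ?thesis
      using tendsto_imp_eventually_ne[OF tendsto_vec_nth[OF tendsto_vec_nth[OF lim]]]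
      by (auto elim: eventually_mono)
  qed simp
  then have "\<forall>\<^sub>F B in nhds 0. \<forall>j k. A $ j $ k \<noteq> 0 \<longrightarrow> (A + pattern_sym E B) $ j $ k \<noteq> 0"
    by (intro eventually_all_finite)
  with inj show ?thesis
  proof eventually_elim
    case (elim B)
    have "symmetric_mat (A + pattern_sym E B)"
      using A by (auto simp: graph_matrices_def symmetric_mat_def transpose_def pattern_sym_def
          vec_eq_iff insert_commute)
    moreover have "(A + pattern_sym E B) $ j $ k \<noteq> 0 \<longleftrightarrow> {j, k} \<in> E" if "j \<noteq> k" for j k
    proof (cases "{j, k} \<in> E")
      case True
      then show ?thesis
        using A that elim(2) by (simp add: graph_matrices_def)
    next
      case False
      then show ?thesis
        using A that by (simp add: graph_matrices_def pattern_sym_def)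
    qed
    ultimately have "A + pattern_sym E B \<in> graph_matrices E"
      by (simp add: graph_matrices_def)
    with elim(1) show ?case
      by (simp add: SNIP_iff_injective_on_off_pattern)
  qed
qed

text \<open>\<open>L\<close> is the derivative at \<open>0\<close> of the congruence map with a
  skew-symmetric summand added. If it were not onto, some nonzero \<open>X\<close> would be
  orthogonal to its range; testing \<open>X\<close> against each of the three parameters yields the
  conditions that the SNIP forbids.\<close>

lemma SNIP_tangent_map_surj:
  fixes A :: "real^'n^'n"
  assumes A: "A \<in> graph_matrices E" and "SNIP i A"
  defines "L \<equiv> \<lambda>z. transpose (drop_row i (fst z)) ** A + A ** drop_row i (fst z)
      + pattern_sym E (fst (snd z)) + (snd (snd z) - transpose (snd (snd z)))"
  assumes "linear L"
  shows "surj L"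
proof (rule ccontr)
  assume "\<not> surj L"
  moreover have sub: "subspace (range L)"
    using \<open>linear L\<close> by (simp add: linear_subspace_image)
  ultimately have "span (range L) \<subset> span UNIV"
    by (auto simp: span_eq_iff[THEN iffD2])
  then obtain X where X: "X \<noteq> 0" "\<And>y. y \<in> range L \<Longrightarrow> orthogonal X y"
    using orthogonal_to_subspace_exists_gen[of "range L" UNIV] span_base by metis
  have orth: "X \<bullet> L (P, Q, R) = 0" for P Q R
    using X(2) by (auto simp: orthogonal_def)
  have At: "transpose A = A"
    using A by (simp add: graph_matrices_def symmetric_mat_def)
  note zeros = linear_0[OF bounded_linear.linear[OF bounded_linear_drop_row]]
    linear_0[OF bounded_linear.linear[OF bounded_linear_pattern_sym]]
    linear_0[OF bounded_linear.linear[OF bounded_linear_transpose]]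
    bounded_bilinear.zero_left[OF bounded_bilinear_matrix_matrix_mult]
    bounded_bilinear.zero_right[OF bounded_bilinear_matrix_matrix_mult]
  \<comment> \<open>The third parameter is tested at \<open>X\<close> itself: the inner product is
    half the squared norm of \<open>X - transpose X\<close>, so \<open>X\<close> is
    symmetric.\<close>
  have "X \<bullet> (X - transpose X) = 0"
    using orth[of 0 0 X] by (simp add: L_def zeros)
  moreover have "transpose X \<bullet> (X - transpose X) = - (X \<bullet> (X - transpose X))"
    by (simp add: inner_diff_right inner_transpose_left)
  ultimately have "(X - transpose X) \<bullet> (X - transpose X) = 0"
    by (simp add: inner_diff_left)
  then have Xt: "transpose X = X"
    by simp
  then have Xsym: "X $ j $ k = X $ k $ j" for j k
    by (metis transpose_def vec_lambda_beta)
  \<comment> \<open>The second parameter at \<open>X\<close> gives a sum of squares over the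
    pattern.\<close>
  have "X \<bullet> pattern_sym E X = 0"
    using orth[of 0 X 0] by (simp add: L_def zeros)
  moreover have "X \<bullet> pattern_sym E X =
      (\<Sum>j\<in>UNIV. \<Sum>k\<in>UNIV. if j = k \<or> {j, k} \<in> E then 2 * (X $ j $ k)\<^sup>2 else 0)"
    unfolding inner_vec_def pattern_sym_def
    by (intro sum.cong refl) (simp add: Xsym power2_eq_square)
  ultimately have "X $ j $ k = 0" if "j = k \<or> {j, k} \<in> E" for j k
    using that by (simp add: sum_nonneg_eq_0_iff sum_nonneg)
      (metis mult_eq_0_iff power_eq_0_iff zero_neq_numeral)
  then have "X \<in> off_pattern E"
    using Xt by (simp add: off_pattern_def symmetric_mat_def)
  have "X \<bullet> (transpose Y ** A) = (A ** X) \<bullet> Y" "X \<bullet> (A ** Y) = (A ** X) \<bullet> Y" for Y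
  proof -
    show "X \<bullet> (A ** Y) = (A ** X) \<bullet> Y"
      by (simp add: inner_matrix_mult_right At)
    have "X \<bullet> (transpose Y ** A) = X \<bullet> transpose (A ** Y)"
      by (simp add: matrix_transpose_mul At)
    also have "\<dots> = (A ** X) \<bullet> Y"
      by (simp add: inner_transpose_left[symmetric] Xt inner_matrix_mult_right At)
    finally show "X \<bullet> (transpose Y ** A) = (A ** X) \<bullet> Y" .
  qed
  \<comment> \<open>With the first parameter at \<open>A ** X\<close>, both product terms of
    \<open>L\<close> contribute the squared norm of \<open>drop_row i (A ** X)\<close>.\<close>
  then have "(A ** X) \<bullet> drop_row i (A ** X) = 0"
    using orth[of "A ** X" 0 0] by (simp add: L_def zeros inner_add_right)
  then have "drop_row i (A ** X) = 0"
    by (simp add: inner_drop_row_self)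
  then show False
    using assms \<open>X \<in> off_pattern E\<close> \<open>X \<noteq> 0\<close> by (auto simp: SNIP_iff_injective_on_off_pattern)
qed

section \<open>Nullity pairs under congruence\<close>

text \<open>The kernel of \<open>A(i)\<close> is the right radical of the form
  \<open>y \<bullet> (A *v x)\<close> restricted to the hyperplane \<open>x $ i = 0\<close>. In this
  shape it can be transported by a congruence.\<close>

lemma kernel_delete_altdef:
  fixes A :: "real^'n^'n"
  shows "kernel_delete i A = {x. x $ i = 0 \<and> (\<forall>y. y $ i = 0 \<longrightarrow> y \<bullet> (A *v x) = 0)}"
proof -
  have sum: "(\<Sum>k\<in>- {i}. A $ j $ k * x $ k) = (A *v x) $ j" if "x $ i = 0" for x j
    unfolding matrix_vector_mult_def using that
    by (auto intro!: sum.mono_neutral_left)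
  have "(\<forall>j\<in>- {i}. v $ j = 0) \<longleftrightarrow> (\<forall>y. y $ i = 0 \<longrightarrow> y \<bullet> v = 0)" for v :: "real^'n"
  proof
    assume "\<forall>j\<in>- {i}. v $ j = 0"
    then show "\<forall>y. y $ i = 0 \<longrightarrow> y \<bullet> v = 0"
      by (auto simp: inner_vec_def intro!: sum.neutral)
  next
    assume "\<forall>y. y $ i = 0 \<longrightarrow> y \<bullet> v = 0"
    then have "axis j 1 \<bullet> v = 0" if "j \<noteq> i" for j
      using that by (simp add: axis_def)
    then show "\<forall>j\<in>- {i}. v $ j = 0"
      by (simp add: inner_axis')
  qed
  note this[of "A *v x" for x, symmetric]
  with sum show ?thesis
    unfolding kernel_delete_def by (simp cong: conj_cong)
qed

text \<open>\<open>C\<close> is bijective and, by the condition on its row \<open>i\<close>, maps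
  the hyperplane \<open>x $ i = 0\<close> onto itself. It therefore carries the radicals of the
  transformed form, on the whole space and on the hyperplane, onto those of
  \<open>A\<close>.\<close>

lemma nullity_pair_congruence:
  fixes A C :: "real^'n^'n"
  assumes inj: "inj ((*v) C)" and row: "\<And>x. (C *v x) $ i = x $ i"
  shows "nullity_pair i (transpose C ** A ** C) = nullity_pair i A"
proof -
  have surj: "surj ((*v) C)"
    using inj linear_injective_imp_surjective[OF matrix_vector_mul_linear] by blast
  have form: "y \<bullet> ((transpose C ** A ** C) *v x) = (C *v y) \<bullet> (A *v (C *v x))" for x y
    by (metis dot_lmul_matrix matrix_vector_mul_assoc transpose_matrix_vector transpose_transpose)
  have dim: "dim S = dim T" if "\<And>x. x \<in> S \<longleftrightarrow> C *v x \<in> T" for S T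
  proof -
    have "(*v) C ` S = T"
      using that surj by (auto simp: image_iff) (metis surjD)
    then show ?thesis
      using dim_image_eq[OF matrix_vector_mul_linear inj_on_subset[OF inj subset_UNIV]] by metis
  qed
  have kernel: "B *v x = 0 \<longleftrightarrow> (\<forall>y. y \<bullet> (B *v x) = 0)" for B :: "real^'n^'n" and x
    by (metis inner_eq_zero_iff inner_zero_right)
  have "nullity (transpose C ** A ** C) = nullity A"
    unfolding nullity_def
    by (rule dim, unfold mem_Collect_eq kernel form) (metis surjD[OF surj])
  moreover have "nullity_delete i (transpose C ** A ** C) = nullity_delete i A"
    unfolding nullity_delete_def
    by (rule dim, unfold kernel_delete_altdef mem_Collect_eq form row) (metis surjD[OF surj] row)
  ultimately show ?thesis
    by (simp add: nullity_pair_def)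
qed

theorem theorem3p2:
  fixes E :: "'n::finite set set" and i :: 'n and A :: "real^'n^'n"
    and N :: "real^'n^'n \<Rightarrow> real"
  assumes "simple_graph E"
    and "is_norm N"
    and "A \<in> graph_matrices E"
    and "SNIP i A"
  shows "\<exists>\<epsilon>>0. \<forall>M::real^'n^'n. symmetric_mat M \<and> N (M - A) < \<epsilon> \<longrightarrow>
           (\<exists>A'\<in>graph_matrices E. SNIP i A' \<and> nullity_pair i M = nullity_pair i A')"
proof -
  interpret mm: bounded_bilinear "(**) :: real^'n^'n \<Rightarrow> real^'n^'n \<Rightarrow> real^'n^'n"
    by (rule bounded_bilinear_matrix_matrix_mult)
  interpret row: bounded_linear "drop_row i"
    by (rule bounded_linear_drop_row)
  interpret pat: bounded_linear "pattern_sym E"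
    by (rule bounded_linear_pattern_sym)
  interpret tr: bounded_linear "transpose :: real^'n^'n \<Rightarrow> real^'n^'n"
    by (rule bounded_linear_transpose)
  \<comment> \<open>A parameter \<open>z\<close> is a triple of unrestricted matrices: the first
    perturbs the congruence, the second perturbs \<open>A\<close> within its pattern, the third
    supplies a skew-symmetric part.\<close>
  define C where "C z = mat 1 + drop_row i (fst z)"
    for z :: "(real^'n^'n) \<times> (real^'n^'n) \<times> (real^'n^'n)"
  define B where "B z = A + pattern_sym E (fst (snd z))"
    for z :: "(real^'n^'n) \<times> (real^'n^'n) \<times> (real^'n^'n)"
  \<comment> \<open>The skew-symmetric summand makes the whole matrix space the target; it vanishes wherever
    the value is symmetric.\<close>
  define f where "f z = transpose (C z) ** B z ** C z + (snd (snd z) - transpose (snd (snd z)))"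
    for z
  \<comment> \<open>The product rule at \<open>0\<close>, where \<open>C 0 = mat 1\<close> and
    \<open>B 0 = A\<close>, gives this derivative of \<open>f\<close>.\<close>
  define L where "L \<equiv> \<lambda>z. transpose (drop_row i (fst z)) ** A + A ** drop_row i (fst z)
      + pattern_sym E (fst (snd z)) + (snd (snd z) - transpose (snd (snd z)))"
  \<comment> \<open>These are the parameters for which \<open>B z\<close> is an admissible
    \<open>A'\<close> and \<open>C z\<close> is invertible.\<close>
  define T where "T = {z. inj ((*v) (C z)) \<and> B z \<in> graph_matrices E \<and> SNIP i (B z)}"
  have C0: "C 0 = mat 1" and B0: "B 0 = A"
    by (simp_all add: C_def B_def row.zero pat.zero)
  have f0: "f 0 = A"
    by (simp add: f_def C0 B0 tr.zero)
  have "(C \<longlongrightarrow> C 0) (nhds 0)"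
    unfolding C_def
    by (intro tendsto_add tendsto_const row.tendsto tendsto_fst[OF filterlim_ident])
  then have C_lim: "(C \<longlongrightarrow> mat 1) (nhds 0)"
    by (simp add: C0)
  have "\<forall>\<^sub>F C in nhds (mat 1 :: real^'n^'n). \<forall>x\<in>UNIV. C *v x = 0 \<longrightarrow> x = 0"
    by (rule eventually_bilinear_injective_on[OF bounded_bilinear_matrix_vector_mult]) auto
  then have "\<forall>\<^sub>F C in nhds (mat 1 :: real^'n^'n). inj ((*v) C)"
    by (rule eventually_mono) (simp add: linear_injective_0)
  then have "\<forall>\<^sub>F z in nhds 0. inj ((*v) (C z))"
    using C_lim by (rule eventually_compose_filterlim)
  moreover have "\<forall>\<^sub>F z in nhds 0. B z \<in> graph_matrices E \<and> SNIP i (B z)"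
  proof -
    have "((\<lambda>z :: (real^'n^'n) \<times> (real^'n^'n) \<times> (real^'n^'n). fst (snd z))
        \<longlongrightarrow> 0) (nhds 0)"
      by (rule tendsto_eq_intros filterlim_ident refl)+ simp
    then show ?thesis
      unfolding B_def
      by (rule eventually_compose_filterlim[OF eventually_graph_matrices_SNIP[OF assms(3,4)]])
  qed
  ultimately have "\<forall>\<^sub>F z in nhds 0. z \<in> T"
    unfolding T_def by eventually_elim simp
  then have "0 \<in> interior T"
    by (auto simp: eventually_nhds interior_def)
  have C': "(C has_derivative (\<lambda>z. drop_row i (fst z))) (at 0)"
    unfolding C_def by (auto intro!: derivative_eq_intros row.has_derivative)
  have B': "(B has_derivative (\<lambda>z. pattern_sym E (fst (snd z)))) (at 0)"
    unfolding B_def by (auto intro!: derivative_eq_intros pat.has_derivative)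
  have S': "((\<lambda>z. snd (snd z) - transpose (snd (snd z))) has_derivative
      (\<lambda>z. snd (snd z) - transpose (snd (snd z))))
      (at (0 :: (real^'n^'n) \<times> (real^'n^'n) \<times> (real^'n^'n)))"
    by (auto intro!: derivative_eq_intros tr.has_derivative)
  have f': "(f has_derivative L) (at 0)"
    unfolding f_def
    by (rule has_derivative_eq_rhs[OF has_derivative_add[OF
            mm.FDERIV[OF mm.FDERIV[OF tr.has_derivative[OF C'] B'] C'] S']])
      (simp add: L_def C0 B0 fun_eq_iff algebra_simps)
  have "linear L"
    using f' by (rule has_derivative_linear)
  moreover from this have "surj L"
    using SNIP_tangent_map_surj[OF assms(3,4)] unfolding L_def by blast
  ultimately obtain g where "linear g" "L \<circ> g = id"
    using linear_surjective_right_inverse by blast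
  have "continuous_on UNIV f"
    unfolding f_def C_def B_def
    by (intro continuous_intros mm.continuous_on tr.continuous_on row.continuous_on
        pat.continuous_on)
  \<comment> \<open>The open mapping theorem at a point applies: \<open>f\<close> is continuous and
    its derivative at \<open>0\<close> has the right inverse \<open>g\<close>.\<close>
  then have "f 0 \<in> interior (f ` T)"
    using f' \<open>linear g\<close> \<open>L \<circ> g = id\<close> \<open>0 \<in> interior T\<close>
    by (intro sussmann_open_mapping[of UNIV]) (auto simp: linear_conv_bounded_linear)
  then obtain e where e: "e > 0" "ball A e \<subseteq> f ` T"
    by (auto simp: f0 mem_interior)
  obtain c where c: "c > 0" "\<And>X. c * norm X \<le> N X"
    using is_norm_ge_scaled_norm[OF assms(2)] by blast
  \<comment> \<open>The radius \<epsilon> is \<open>c * e\<close>, since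
    \<open>c * norm X \<le> N X\<close> then places \<open>M\<close> in
    \<open>ball A e\<close>.\<close>
  have "\<exists>A'\<in>graph_matrices E. SNIP i A' \<and> nullity_pair i M = nullity_pair i A'"
    if M: "symmetric_mat M" "N (M - A) < c * e" for M
  proof -
    have "c * norm (M - A) < c * e"
      using c(2)[of "M - A"] M(2) by linarith
    then have "M \<in> ball A e"
      using c(1) by (simp add: dist_norm norm_minus_commute)
    then obtain z where z: "z \<in> T" "M = f z"
      using e(2) by blast
    define K where "K = snd (snd z) - transpose (snd (snd z))"
    have M_eq: "M = transpose (C z) ** B z ** C z + K"
      by (simp add: z(2) f_def K_def)
    have "transpose (B z) = B z"
      using z(1) by (simp add: T_def graph_matrices_def symmetric_mat_def)
    \<comment> \<open>Transposition fixes \<open>M\<close> and the congruence term but negates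
      \<open>K\<close>.\<close>
    then have "transpose M = transpose (C z) ** B z ** C z - K"
      by (simp add: M_eq K_def tr.add tr.diff matrix_transpose_mul matrix_mul_assoc)
    then have "K + K = 0"
      using M(1) M_eq by (simp add: symmetric_mat_def algebra_simps)
    then have "K = 0"
      by (metis scaleR_2 scaleR_eq_0_iff zero_neq_numeral)
    then have "M = transpose (C z) ** B z ** C z"
      using M_eq by simp
    moreover have "(C z *v x) $ i = x $ i" for x
      by (simp add: C_def drop_row_def matrix_vector_mult_add_rdistrib matrix_vector_mult_def)
        (simp add: mat_def if_distrib[where f = "\<lambda>a. a * _"] cong: if_cong)
    ultimately have "nullity_pair i M = nullity_pair i (B z)"
      using z(1) by (simp add: T_def nullity_pair_congruence)
    then show ?thesis
      using z(1) by (auto simp: T_def)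
  qed
  then show ?thesis
    using c(1) e(1) by (intro exI[of _ "c * e"]) auto
qed

end
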